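(* Let $B = (B, \circ, \cdot)$ be a skew left brace, and for $x, y \in B$ let $\sigma_x(y) = x^{-1} \cdot (x \circ y)$ and $\tau_y(x) = \overline{\sigma_x(y)} \circ x \circ y$. Then $\tau : y \mapsto \tau_y$ is an anti-homomorphism from the group $(B, \circ)$ to $\mathrm{Perm}(B)$; that is, each map $\tau_y : B \to B$ is a permutation of $B$, and for all $x, y, z \in B$, \[ \tau_{y \circ z}(x) = \tau_z(\tau_y(x)). \]
   Context: A skew left brace is a set $B$ with two group operations $\circ$ and $\cdot$ (neither assumed commutative) satisfying the single compatibility condition \[ x \circ (y \cdot z) = (x \circ y) \cdot x^{-1} \cdot (x \circ z) \quad \text{for all } x, y, z \in B. \] Here $x^{-1}$ denotes the inverse of $x$ in the group $(B, \cdot)$ and $\overline{x}$ denotes the inverse of $x$ in the group $(B, \circ)$. $\mathrm{Perm}(B)$ denotes the group of all permutations (bijections $B \to B$) of the set $B$ under composition. *)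

theory Defs
  imports "HOL-Algebra.Group" "HOL-Algebra.Bij"
begin

(* The brace (B, \<circ>, \<cdot>) is given by two group structures on the same carrier:
   C is (B, \<circ>) and D is (B, \<cdot>). *)
locale skew_left_brace =
  circ: group C + dot: group D
  for C :: "('a, 'c) monoid_scheme" and D :: "('a, 'd) monoid_scheme" +
  assumes carrier_eq: "carrier C = carrier D"
    and compat: "\<lbrakk>x \<in> carrier C; y \<in> carrier C; z \<in> carrier C\<rbrakk> \<Longrightarrow>
      x \<otimes>\<^bsub>C\<^esub> (y \<otimes>\<^bsub>D\<^esub> z)
        = (x \<otimes>\<^bsub>C\<^esub> y) \<otimes>\<^bsub>D\<^esub> (inv\<^bsub>D\<^esub> x) \<otimes>\<^bsub>D\<^esub> (x \<otimes>\<^bsub>C\<^esub> z)"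

definition brace_sigma ::
    "('a, 'c) monoid_scheme \<Rightarrow> ('a, 'd) monoid_scheme \<Rightarrow> 'a \<Rightarrow> 'a \<Rightarrow> 'a"
  where "brace_sigma C D x y = (inv\<^bsub>D\<^esub> x) \<otimes>\<^bsub>D\<^esub> (x \<otimes>\<^bsub>C\<^esub> y)"

(* The subscript comes first: brace_tau C D y x is \<tau>\<^sub>y(x). *)
definition brace_tau ::
    "('a, 'c) monoid_scheme \<Rightarrow> ('a, 'd) monoid_scheme \<Rightarrow> 'a \<Rightarrow> 'a \<Rightarrow> 'a"
  where "brace_tau C D y x = (inv\<^bsub>C\<^esub> (brace_sigma C D x y)) \<otimes>\<^bsub>C\<^esub> x \<otimes>\<^bsub>C\<^esub> y"

definition anti_hom ::
    "('a, 'c) monoid_scheme \<Rightarrow> ('b, 'd) monoid_scheme \<Rightarrow> ('a \<Rightarrow> 'b) set"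
  where "anti_hom G H =
    {h \<in> carrier G \<rightarrow> carrier H.
       \<forall>x\<in>carrier G. \<forall>y\<in>carrier G. h (x \<otimes>\<^bsub>G\<^esub> y) = h y \<otimes>\<^bsub>H\<^esub> h x}"

end

theory Submission
  imports Defs
begin

text \<open>
  By the definition of \<tau>, a product \<open>x \<circ> y\<close> factorises as \<open>\<sigma>\<^sub>x(y) \<circ> \<tau>\<^sub>y(x)\<close>, so once
  \<sigma> is understood, identities for \<tau> follow by cancellation in \<open>(B, \<circ>)\<close>.  The other reading of
  \<sigma> is \<open>x \<circ> y = x \<cdot> \<sigma>\<^sub>x(y)\<close>, and compatibility says exactly that
  \<open>x \<circ> (y \<cdot> z) = (x \<circ> y) \<cdot> \<sigma>\<^sub>x(z)\<close>.  From these, \<sigma> is an action of \<open>(B, \<circ>)\<close> by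
  endomorphisms of \<open>(B, \<cdot>)\<close> (lemmas \<open>sigma_dot\<close> and \<open>sigma_circ_left\<close>), whence
  \<open>\<sigma>\<^sub>x(y \<circ> z) = \<sigma>\<^sub>x(y) \<circ> \<sigma>\<^sub>t(z)\<close> for \<open>t = \<tau>\<^sub>y(x)\<close> (lemma \<open>sigma_circ_right\<close>).

  Now split \<open>x \<circ> y \<circ> z\<close> in two ways: directly as \<open>\<sigma>\<^sub>x(y \<circ> z)\<close> followed by the value of \<open>\<tau>\<close> at
  \<open>y \<circ> z\<close>, and by moving first \<open>y\<close> and then \<open>z\<close> to the left past \<open>x\<close>.  The left factors agree
  by the last identity, so the right factors agree too, which is
  \<open>\<tau>\<^bsub>y \<circ> z\<^esub>(x) = \<tau>\<^sub>z(\<tau>\<^sub>y(x))\<close>.  Since \<tau> at the identity is the identity map, the maps at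
  \<open>y\<close> and at the \<open>\<circ>\<close>-inverse of \<open>y\<close> are mutually inverse, so each one is a permutation.
\<close>

context skew_left_brace
begin

abbreviation circ_mult (infixl "\<odot>" 70) where "x \<odot> y \<equiv> x \<otimes>\<^bsub>C\<^esub> y"
abbreviation dot_mult (infixl "\<bullet>" 70) where "x \<bullet> y \<equiv> x \<otimes>\<^bsub>D\<^esub> y"
abbreviation "\<sigma> \<equiv> brace_sigma C D"
abbreviation "\<tau> \<equiv> brace_tau C D"

lemma sigma_closed: "x \<in> carrier C \<Longrightarrow> y \<in> carrier C \<Longrightarrow> \<sigma> x y \<in> carrier C"
  unfolding brace_sigma_def using carrier_eq circ.m_closed[of x y] by simp

lemma tau_closed: "x \<in> carrier C \<Longrightarrow> y \<in> carrier C \<Longrightarrow> \<tau> y x \<in> carrier C"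
  unfolding brace_tau_def using sigma_closed by simp

lemma dot_sigma:
  assumes "x \<in> carrier C" "y \<in> carrier C"
  shows "x \<bullet> \<sigma> x y = x \<odot> y"
  using assms carrier_eq circ.m_closed[of x y]
  by (simp add: brace_sigma_def dot.m_assoc[symmetric])

lemma sigma_circ_tau:
  assumes "x \<in> carrier C" "y \<in> carrier C"
  shows "\<sigma> x y \<odot> \<tau> y x = x \<odot> y"
  using assms sigma_closed[of x y]
  by (simp add: brace_tau_def circ.m_assoc[symmetric])

lemma circ_dot:
  assumes "x \<in> carrier C" "y \<in> carrier C" "z \<in> carrier C"
  shows "x \<odot> (y \<bullet> z) = (x \<odot> y) \<bullet> \<sigma> x z"
  using assms carrier_eq circ.m_closed[of x y] circ.m_closed[of x z]
  by (simp add: compat brace_sigma_def dot.m_assoc)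

text \<open>Compatibility with the identity \<open>e\<close> of \<open>(B, \<circ>)\<close> as the acting element reads
  \<open>y \<cdot> z = y \<cdot> e\<^sup>-\<^sup>1 \<cdot> z\<close>, where \<open>e\<^sup>-\<^sup>1\<close> is the inverse in \<open>(B, \<cdot>)\<close>; cancellation leaves
  \<open>e\<^sup>-\<^sup>1\<close> neutral for \<open>\<cdot>\<close>.\<close>

lemma one_eq: "\<one>\<^bsub>C\<^esub> = \<one>\<^bsub>D\<^esub>"
proof -
  have C1: "\<one>\<^bsub>C\<^esub> \<in> carrier D" and D1: "\<one>\<^bsub>D\<^esub> \<in> carrier C"
    using carrier_eq circ.one_closed by auto
  have "\<one>\<^bsub>D\<^esub> = inv\<^bsub>D\<^esub> \<one>\<^bsub>C\<^esub>"
    using compat[OF circ.one_closed D1 D1] C1 D1 by simp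
  then show ?thesis
    using C1 by (metis dot.inv_inv dot.inv_one)
qed

lemma sigma_dot:
  assumes "x \<in> carrier C" "y \<in> carrier C" "z \<in> carrier C"
  shows "\<sigma> x (y \<bullet> z) = \<sigma> x y \<bullet> \<sigma> x z"
proof -
  have "\<sigma> x (y \<bullet> z) = (inv\<^bsub>D\<^esub> x) \<bullet> ((x \<odot> y) \<bullet> \<sigma> x z)"
    using assms by (simp add: brace_sigma_def[of C D x "y \<bullet> z"] circ_dot)
  also have "\<dots> = \<sigma> x y \<bullet> \<sigma> x z"
    using assms carrier_eq circ.m_closed[of x y] sigma_closed[of x z]
    by (simp add: brace_sigma_def[of C D x y] dot.m_assoc)
  finally show ?thesis .
qed

text \<open>Both sides, multiplied on the left by \<open>x \<circ> y\<close> in \<open>(B, \<cdot>)\<close>, give \<open>x \<circ> y \<circ> z\<close>.\<close>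

lemma sigma_circ_left:
  assumes "x \<in> carrier C" "y \<in> carrier C" "z \<in> carrier C"
  shows "\<sigma> (x \<odot> y) z = \<sigma> x (\<sigma> y z)"
proof -
  have "(x \<odot> y) \<bullet> \<sigma> (x \<odot> y) z = x \<odot> (y \<odot> z)"
    using assms by (simp add: dot_sigma circ.m_assoc)
  also have "\<dots> = x \<odot> (y \<bullet> \<sigma> y z)"
    using assms by (simp add: dot_sigma)
  also have "\<dots> = (x \<odot> y) \<bullet> \<sigma> x (\<sigma> y z)"
    using assms by (simp add: circ_dot sigma_closed)
  finally show ?thesis
    using assms carrier_eq circ.m_closed sigma_closed by (metis dot.Units_eq dot.Units_l_cancel)
qed

text \<open>The failure of \<open>\<sigma>\<^sub>x\<close> to respect \<open>\<circ>\<close> is measured by \<tau>: the action of \<open>x \<circ> y\<close> is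
  recomputed from its other factorisation \<open>\<sigma>\<^sub>x(y) \<circ> \<tau>\<^sub>y(x)\<close>.\<close>

lemma sigma_circ_right:
  assumes "x \<in> carrier C" "y \<in> carrier C" "z \<in> carrier C"
  shows "\<sigma> x (y \<odot> z) = \<sigma> x y \<odot> \<sigma> (\<tau> y x) z"
proof -
  have "\<sigma> x (y \<odot> z) = \<sigma> x y \<bullet> \<sigma> x (\<sigma> y z)"
    using assms by (simp add: dot_sigma[symmetric] sigma_dot sigma_closed)
  also have "\<dots> = \<sigma> x y \<bullet> \<sigma> (\<sigma> x y \<odot> \<tau> y x) z"
    using assms by (simp add: sigma_circ_left[symmetric] sigma_circ_tau)
  also have "\<dots> = \<sigma> x y \<bullet> \<sigma> (\<sigma> x y) (\<sigma> (\<tau> y x) z)"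
    using assms by (simp add: sigma_circ_left sigma_closed tau_closed)
  also have "\<dots> = \<sigma> x y \<odot> \<sigma> (\<tau> y x) z"
    using assms by (simp add: dot_sigma sigma_closed tau_closed)
  finally show ?thesis .
qed

lemma tau_circ:
  assumes "x \<in> carrier C" "y \<in> carrier C" "z \<in> carrier C"
  shows "\<tau> (y \<odot> z) x = \<tau> z (\<tau> y x)"
proof -
  note closed = sigma_closed tau_closed assms
  have "\<sigma> x (y \<odot> z) \<odot> \<tau> (y \<odot> z) x = (x \<odot> y) \<odot> z"
    using assms by (simp add: sigma_circ_tau circ.m_assoc)
  also have "\<dots> = \<sigma> x y \<odot> (\<tau> y x \<odot> z)"
    using closed by (simp add: circ.m_assoc[symmetric] sigma_circ_tau)
  also have "\<dots> = \<sigma> x y \<odot> (\<sigma> (\<tau> y x) z \<odot> \<tau> z (\<tau> y x))"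
    using closed by (simp add: sigma_circ_tau)
  also have "\<dots> = \<sigma> x (y \<odot> z) \<odot> \<tau> z (\<tau> y x)"
    using closed by (simp add: sigma_circ_right circ.m_assoc)
  finally show ?thesis
    using closed by simp
qed

lemma tau_one:
  assumes "x \<in> carrier C"
  shows "\<tau> \<one>\<^bsub>C\<^esub> x = x"
proof -
  have "\<sigma> x \<one>\<^bsub>C\<^esub> = \<one>\<^bsub>C\<^esub>"
    using assms carrier_eq by (simp add: brace_sigma_def one_eq[symmetric])
  then show ?thesis
    using assms by (simp add: brace_tau_def)
qed

lemma tau_bij:
  assumes "y \<in> carrier C"
  shows "bij_betw (\<tau> y) (carrier C) (carrier C)"
proof (rule bij_betw_byWitness[where f' = "\<tau> (inv\<^bsub>C\<^esub> y)"])
  show "\<forall>x\<in>carrier C. \<tau> (inv\<^bsub>C\<^esub> y) (\<tau> y x) = x"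
    using assms by (simp add: tau_circ[symmetric] tau_one)
  show "\<forall>x\<in>carrier C. \<tau> y (\<tau> (inv\<^bsub>C\<^esub> y) x) = x"
    using assms by (simp add: tau_circ[symmetric] tau_one)
qed (use assms tau_closed in auto)

end

theorem proposition2:
  fixes C :: "('a, 'c) monoid_scheme" and D :: "('a, 'd) monoid_scheme"
  assumes "skew_left_brace C D"
  shows "(\<lambda>y. restrict (brace_tau C D y) (carrier C)) \<in> anti_hom C (BijGroup (carrier C))
    \<and> (\<forall>y\<in>carrier C. bij_betw (brace_tau C D y) (carrier C) (carrier C))
    \<and> (\<forall>x\<in>carrier C. \<forall>y\<in>carrier C. \<forall>z\<in>carrier C.
          brace_tau C D (y \<otimes>\<^bsub>C\<^esub> z) x = brace_tau C D z (brace_tau C D y x))"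
proof -
  interpret skew_left_brace C D by (fact assms)
  let ?\<tau> = "\<lambda>y. restrict (brace_tau C D y) (carrier C)"
  have Bij: "?\<tau> y \<in> Bij (carrier C)" if "y \<in> carrier C" for y
    using tau_bij[OF that] by (simp add: Bij_def bij_betw_restrict_eq)
  have "?\<tau> (y \<otimes>\<^bsub>C\<^esub> z) = ?\<tau> z \<otimes>\<^bsub>BijGroup (carrier C)\<^esub> ?\<tau> y"
    if "y \<in> carrier C" "z \<in> carrier C" for y z
    using that Bij
    by (auto simp: BijGroup_def compose_def tau_circ tau_closed cong: restrict_cong)
  then have "?\<tau> \<in> anti_hom C (BijGroup (carrier C))"
    using Bij by (auto simp: anti_hom_def BijGroup_def)
  then show ?thesis
    using tau_bij tau_circ by blast
qed

end
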